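(* Let $G$ and $H$ be star forests. If at least one of $G$ and $H$ contains an infinite-star component (a component that is a star with infinitely many edges), then no $(G,H)$-minimal graph exists.
   Context: All graphs are simple and undirected, and may be infinite (even uncountable). For $n\in\mathbb{N}$ (the positive integers), $S_n$ denotes the star with $n$ edges; stars may also be infinite (one center vertex joined to infinitely many leaves, of any infinite cardinality). In particular a star has at least one edge. A star forest is a disjoint union of stars (possibly infinitely many). A copy of a graph $G$ in a graph $F$ is a (not necessarily induced) subgraph of $F$ isomorphic to $G$. We write $F\to(G,H)$ if every red-blue coloring of the edges of $F$ produces a red copy of $G$ (all edges red) or a blue copy of $H$ (all edges blue). A graph $F$ is $(G,H)$-minimal if $F\to(G,H)$ and no proper subgraph $F'$ of $F$ satisfies $F'\to(G,H)$. *)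

theory Defs
  imports Main
begin

record 'a ugraph =
  verts :: "'a set"
  edges :: "'a set set"

definition simple_graph :: "'a ugraph \<Rightarrow> bool" where
  "simple_graph G \<longleftrightarrow> (\<forall>e\<in>edges G. e \<subseteq> verts G \<and> card e = 2)"

definition subgraph :: "'a ugraph \<Rightarrow> 'a ugraph \<Rightarrow> bool" where
  "subgraph K G \<longleftrightarrow> simple_graph K \<and> verts K \<subseteq> verts G \<and> edges K \<subseteq> edges G"

definition isomorphic :: "'a ugraph \<Rightarrow> 'b ugraph \<Rightarrow> bool" where
  "isomorphic G K \<longleftrightarrow>
    (\<exists>f. bij_betw f (verts G) (verts K) \<and>
         (\<forall>u\<in>verts G. \<forall>v\<in>verts G. {u, v} \<in> edges G \<longleftrightarrow> {f u, f v} \<in> edges K))"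

definition is_copy :: "'c ugraph \<Rightarrow> 'a ugraph \<Rightarrow> 'c ugraph \<Rightarrow> bool" where
  "is_copy K G F \<longleftrightarrow> subgraph K F \<and> isomorphic G K"

datatype color = Red | Blue

text \<open>A colouring is a total function on vertex sets; only its values on the edges of
  the graph being coloured matter.\<close>

definition arrows :: "'c ugraph \<Rightarrow> 'a ugraph \<Rightarrow> 'b ugraph \<Rightarrow> bool" where
  "arrows F G H \<longleftrightarrow>
    (\<forall>c :: 'c set \<Rightarrow> color.
      (\<exists>K. is_copy K G F \<and> (\<forall>e\<in>edges K. c e = Red)) \<or>
      (\<exists>K. is_copy K H F \<and> (\<forall>e\<in>edges K. c e = Blue)))"

definition ramsey_minimal :: "'a ugraph \<Rightarrow> 'b ugraph \<Rightarrow> 'c ugraph \<Rightarrow> bool" where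
  "ramsey_minimal G H F \<longleftrightarrow>
    simple_graph F \<and> arrows F G H \<and>
    (\<forall>F'. subgraph F' F \<and> F' \<noteq> F \<longrightarrow> \<not> arrows F' G H)"

definition is_star :: "'a ugraph \<Rightarrow> bool" where
  "is_star S \<longleftrightarrow>
    (\<exists>z L. z \<notin> L \<and> L \<noteq> {} \<and> verts S = insert z L \<and> edges S = (\<lambda>x. {z, x}) ` L)"

definition infinite_star :: "'a ugraph \<Rightarrow> bool" where
  "infinite_star S \<longleftrightarrow> is_star S \<and> infinite (edges S)"

text \<open>The family of stars is required to be nonempty. The graph without vertices would be
  a copy in every graph, so it would itself be minimal for every pair containing it.\<close>

definition star_forest :: "'a ugraph \<Rightarrow> bool" where
  "star_forest G \<longleftrightarrow>
    (\<exists>\<S>. \<S> \<noteq> {} \<and> (\<forall>S\<in>\<S>. is_star S) \<and>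
         (\<forall>S\<in>\<S>. \<forall>T\<in>\<S>. S \<noteq> T \<longrightarrow> verts S \<inter> verts T = {}) \<and>
         verts G = (\<Union>S\<in>\<S>. verts S) \<and> edges G = (\<Union>S\<in>\<S>. edges S))"

definition connected_graph :: "'a ugraph \<Rightarrow> bool" where
  "connected_graph G \<longleftrightarrow> verts G \<noteq> {} \<and>
    (\<forall>u\<in>verts G. \<forall>v\<in>verts G. (\<lambda>x y. {x, y} \<in> edges G)\<^sup>*\<^sup>* u v)"

definition component :: "'a ugraph \<Rightarrow> 'a ugraph \<Rightarrow> bool" where
  "component C G \<longleftrightarrow> subgraph C G \<and> connected_graph C \<and>
    (\<forall>D. subgraph D G \<and> connected_graph D \<and> subgraph C D \<longrightarrow> D = C)"

end

theory Submission
  imports Defs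
begin

text \<open>
  If a graph arrows the pair, colouring it with a single colour shows that it contains a copy of
  the forest with the infinite star, so it has a vertex \<open>v\<close> of infinite degree. The claim is that
  any edge \<open>e = vw\<close> at \<open>v\<close> can be deleted without destroying the arrowing property
  (\<open>arrows_delete_edge\<close>), so that the graph is not minimal.

  Take a colouring of the graph without \<open>e\<close>. One of the two colours, say red, occurs on infinitely
  many of the remaining edges at \<open>v\<close>; give \<open>e\<close> this colour. A blue copy of \<open>H\<close> then avoids \<open>e\<close>.
  A red copy of \<open>G\<close> that uses \<open>e\<close>, in its star \<open>T\<close>, is repaired as follows
  (\<open>forest_embedding_drop_edge\<close>). If \<open>T\<close> is infinite, it can spare the leaf at the end of \<open>e\<close>.
  If \<open>T\<close> has \<open>n\<close> edges with \<open>n\<close> finite, give up \<open>T\<close> altogether. This frees \<open>v\<close>, which is an end of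
  \<open>e\<close>, and the new place for \<open>T\<close> is centred at \<open>v\<close>, with \<open>n\<close> of the infinitely many other red
  neighbours of \<open>v\<close> as leaves.

  Those neighbours may all be occupied by the other stars of the copy. What makes the repair work is
  that a star forest embedding can always be moved, inside its own image, away from some member of
  any given infinite set of its vertices (\<open>forest_embedding_avoid_one\<close>). Either one infinite star
  has infinitely many leaves in the set and can spare one of them, or infinitely many stars meet the
  set. In the latter case the well-ordering of cardinals gives a sequence of such stars in which
  each fits into its successor, and shifting every star of the sequence by one place frees all
  vertices of the first one.
\<close>

section \<open>Embeddings of star forests\<close>

text \<open>
  A star forest is handled as a set \<open>Z\<close> of centres together with the leaf sets \<open>L z\<close>, so that
  removing a star is shrinking \<open>Z\<close> and removing a leaf is updating \<open>L\<close>.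
\<close>

definition forest_verts :: "'a set \<Rightarrow> ('a \<Rightarrow> 'a set) \<Rightarrow> 'a set" where
  "forest_verts Z L = Z \<union> (\<Union>z\<in>Z. L z)"

definition centred_forest :: "'a set \<Rightarrow> ('a \<Rightarrow> 'a set) \<Rightarrow> bool" where
  "centred_forest Z L \<longleftrightarrow>
    (\<forall>z\<in>Z. Z \<inter> L z = {}) \<and> (\<forall>z\<in>Z. \<forall>y\<in>Z. z \<noteq> y \<longrightarrow> L z \<inter> L y = {})"

text \<open>
  The target is a bare set of edges, since the argument only ever looks at the edges of one colour.
\<close>

definition forest_embedding ::
  "('a \<Rightarrow> 'c) \<Rightarrow> 'a set \<Rightarrow> ('a \<Rightarrow> 'a set) \<Rightarrow> 'c set set \<Rightarrow> bool" where
  "forest_embedding f Z L E \<longleftrightarrow>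
    inj_on f (forest_verts Z L) \<and> (\<forall>z\<in>Z. \<forall>x\<in>L z. {f z, f x} \<in> E)"

lemma forest_embeddingI:
  assumes "inj_on f (forest_verts Z L)"
    and "\<And>z x. z \<in> Z \<Longrightarrow> x \<in> L z \<Longrightarrow> {f z, f x} \<in> E"
  shows "forest_embedding f Z L E"
  using assms by (simp add: forest_embedding_def)

lemma centred_forest_subset:
  assumes "centred_forest Z L" "Z' \<subseteq> Z" "\<And>z. z \<in> Z' \<Longrightarrow> L' z \<subseteq> L z"
  shows "centred_forest Z' L'"
  using assms(1) assms(2) assms(3)[THEN subsetD]
  unfolding centred_forest_def by (auto simp: disjoint_iff) (metis subsetD)+

lemma leaf_of_one_star_only:
  assumes "centred_forest Z L"
  shows "\<lbrakk>z \<in> Z; x \<in> L z; y \<in> Z; x \<in> L y\<rbrakk> \<Longrightarrow> z = y"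
    and "\<lbrakk>z \<in> Z; x \<in> L z\<rbrakk> \<Longrightarrow> x \<notin> Z"
  using assms unfolding centred_forest_def by blast+

text \<open>
  Maps of the individual stars glue to a map of the forests, because a leaf determines its star.
\<close>

lemma forest_map_from_stars:
  assumes forest: "centred_forest Z L" and forest': "centred_forest Z' L'"
    and inj: "inj_on \<phi> Z" and into: "\<phi> ` Z \<subseteq> Z'"
    and stars: "\<And>z. z \<in> Z \<Longrightarrow> \<exists>h. inj_on h (L z) \<and> h ` L z \<subseteq> L' (\<phi> z)"
  obtains g where "inj_on g (forest_verts Z L)" "g ` forest_verts Z L \<subseteq> forest_verts Z' L'"
    and "\<And>z. z \<in> Z \<Longrightarrow> g z = \<phi> z" and "\<And>z x. z \<in> Z \<Longrightarrow> x \<in> L z \<Longrightarrow> g x \<in> L' (\<phi> z)"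
proof -
  obtain h where h: "\<And>z. z \<in> Z \<Longrightarrow> inj_on (h z) (L z)"
      "\<And>z. z \<in> Z \<Longrightarrow> h z ` L z \<subseteq> L' (\<phi> z)"
    using stars by metis
  define g where "g x = (if x \<in> Z then \<phi> x else h (THE z. z \<in> Z \<and> x \<in> L z) x)" for x
  have g_centre: "g z = \<phi> z" if "z \<in> Z" for z
    using that by (simp add: g_def)
  have g_leaf: "g x = h z x" if "z \<in> Z" "x \<in> L z" for z x
  proof -
    have "(THE z. z \<in> Z \<and> x \<in> L z) = z"
      using that leaf_of_one_star_only(1)[OF forest] by blast
    then show ?thesis
      using that leaf_of_one_star_only(2)[OF forest] by (simp add: g_def)
  qed
  have g_into: "g x \<in> L' (\<phi> z)" if "z \<in> Z" "x \<in> L z" for z x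
    using that g_leaf h(2) by fastforce
  have \<phi>Z: "\<phi> z \<in> Z'" if "z \<in> Z" for z
    using that into by blast
  have cl: "g z \<noteq> g x" if "z \<in> Z" "y \<in> Z" "x \<in> L y" for x y z
    using that g_centre g_into \<phi>Z leaf_of_one_star_only(2)[OF forest'] by metis
  have ll: "x = x'" if "z \<in> Z" "x \<in> L z" "z' \<in> Z" "x' \<in> L z'" "g x = g x'" for x x' z z'
  proof -
    have "\<phi> z = \<phi> z'"
      using that g_into \<phi>Z leaf_of_one_star_only(1)[OF forest'] by metis
    then have "z = z'"
      using that inj by (auto dest: inj_onD)
    then show ?thesis
      using that g_leaf h(1) by (metis inj_onD)
  qed
  have cc: "z = z'" if "z \<in> Z" "z' \<in> Z" "g z = g z'" for z z'
    using that inj g_centre by (auto dest: inj_onD)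
  show thesis
  proof (rule that[of g])
    show "inj_on g (forest_verts Z L)"
      unfolding forest_verts_def
    proof (rule inj_onI)
      fix x y assume "x \<in> Z \<union> \<Union> (L ` Z)" "y \<in> Z \<union> \<Union> (L ` Z)" "g x = g y"
      then show "x = y"
        using cc cl ll by (metis UN_E Un_iff)
    qed
    show "g ` forest_verts Z L \<subseteq> forest_verts Z' L'"
      using g_into g_centre \<phi>Z unfolding forest_verts_def by fastforce
  qed (use g_centre g_into in auto)
qed

lemma forest_embedding_transfer:
  assumes forest: "centred_forest Z L" and forest': "centred_forest Z' L'"
    and emb: "forest_embedding f Z' L' E"
    and inj: "inj_on \<phi> Z" and into: "\<phi> ` Z \<subseteq> Z'"
    and stars: "\<And>z. z \<in> Z \<Longrightarrow> \<exists>h. inj_on h (L z) \<and> h ` L z \<subseteq> L' (\<phi> z)"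
  obtains f' where "forest_embedding f' Z L E"
    and "f' ` forest_verts Z L \<subseteq> f ` forest_verts Z' L'"
proof -
  obtain g where g: "inj_on g (forest_verts Z L)" "g ` forest_verts Z L \<subseteq> forest_verts Z' L'"
      "\<And>z. z \<in> Z \<Longrightarrow> g z = \<phi> z" "\<And>z x. z \<in> Z \<Longrightarrow> x \<in> L z \<Longrightarrow> g x \<in> L' (\<phi> z)"
    using forest_map_from_stars[OF forest forest' inj into stars] by metis
  show thesis
  proof (rule that[of "f \<circ> g"])
    show "forest_embedding (f \<circ> g) Z L E"
    proof (rule forest_embeddingI)
      show "inj_on (f \<circ> g) (forest_verts Z L)"
        using g(1,2) emb by (metis comp_inj_on forest_embedding_def inj_on_subset)
      show "{(f \<circ> g) z, (f \<circ> g) x} \<in> E" if "z \<in> Z" "x \<in> L z" for z x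
        using that g(3,4) emb into unfolding forest_embedding_def by fastforce
    qed
    show "(f \<circ> g) ` forest_verts Z L \<subseteq> f ` forest_verts Z' L'"
      using g(2) by auto
  qed
qed

text \<open>
  An infinite leaf set has a bijection onto itself minus one point, so an embedding of the forest
  with the leaf \<open>b\<close> missing already contains an embedding of the whole forest.
\<close>

lemma forest_embedding_fill_star:
  assumes forest: "centred_forest Z L" and z: "z \<in> Z" and inf: "infinite (L z)"
    and emb: "forest_embedding f Z (L(z := L z - {b})) E"
  obtains f' where "forest_embedding f' Z L E"
    and "f' ` forest_verts Z L \<subseteq> f ` forest_verts Z (L(z := L z - {b}))"
proof (rule forest_embedding_transfer[OF forest _ emb, where \<phi> = id])
  show "centred_forest Z (L(z := L z - {b}))"
    using forest by (rule centred_forest_subset) auto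
  obtain h where "bij_betw h (L z) (L z - {b})"
    using infinite_imp_bij_betw[OF inf] by metis
  then have "inj_on h (L z)" "h ` L z \<subseteq> L z - {b}"
    by (auto simp: bij_betw_def)
  moreover have "inj_on id (L y)" "id ` L y \<subseteq> L y" for y
    by auto
  ultimately show "\<exists>h. inj_on h (L y) \<and> h ` L y \<subseteq> (L(z := L z - {b})) (id y)" for y
    by (cases "y = z") (metis fun_upd_apply id_apply)+
qed (use that in auto)

section \<open>Moving an embedding away from given vertices\<close>

text \<open>
  Repeatedly remove an index whose set has least cardinality: what is chosen later was a candidate
  before, and hence is at least as large.
\<close>

lemma increasing_sequence_of_sets:
  includes cardinal_syntax
  fixes A :: "'i \<Rightarrow> 'b set"
  assumes "infinite I"
  obtains s :: "nat \<Rightarrow> 'i"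
  where "inj s" "range s \<subseteq> I" "\<And>n. \<exists>h. inj_on h (A (s n)) \<and> h ` A (s n) \<subseteq> A (s (Suc n))"
proof -
  have min: "\<exists>i\<in>J. \<forall>j\<in>J. |A i| \<le>o |A j|" if "J \<noteq> {}" for J
  proof -
    have "(\<lambda>i. |A i| ) ` J \<noteq> {}"
      using that by simp
    then obtain m where m: "m \<in> (\<lambda>i. |A i| ) ` J"
        "\<And>r. (r, m) \<in> ordLess \<Longrightarrow> r \<notin> (\<lambda>i. |A i| ) ` J"
      by (rule wfE_min'[OF wf_ordLess]) blast
    then obtain i where i: "i \<in> J" "m = |A i|"
      by blast
    have "|A i| \<le>o |A j|" if "j \<in> J" for j
    proof -
      have "\<not> |A j| <o |A i|"
        using m(2)[of "|A j|"] i(2) that by blast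
      then show ?thesis
        using ordLess_or_ordLeq[OF card_of_Well_order card_of_Well_order] by metis
    qed
    then show ?thesis
      using i(1) by blast
  qed
  define pick where "pick J = (SOME i. i \<in> J \<and> (\<forall>j\<in>J. |A i| \<le>o |A j| ))" for J
  have pick: "pick J \<in> J" "\<And>j. j \<in> J \<Longrightarrow> |A (pick J)| \<le>o |A j|" if "J \<noteq> {}" for J
    using someI_ex[of "\<lambda>i. i \<in> J \<and> (\<forall>j\<in>J. |A i| \<le>o |A j| )"] min[OF that]
    unfolding pick_def by blast+
  define J where "J n = ((\<lambda>J. J - {pick J}) ^^ n) I" for n
  have J_Suc: "J (Suc n) = J n - {pick (J n)}" for n
    by (simp add: J_def)
  have J_inf: "infinite (J n)" for n
    by (induction n) (auto simp: J_Suc, simp add: J_def assms)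
  have J_mono: "J n \<subseteq> J m" if "m \<le> n" for m n
    using that by (rule lift_Suc_antimono_le[rotated]) (auto simp: J_Suc)
  have J_ne: "J n \<noteq> {}" for n
    using J_inf by (metis finite.emptyI)
  note pickJ = pick[OF J_ne]
  have less: "pick (J m) \<noteq> pick (J n)" if "m < n" for m n
    using pickJ(1)[of n] J_mono[of "Suc m" n] that by (auto simp: J_Suc)
  show thesis
  proof (rule that[of "\<lambda>n. pick (J n)"])
    show "inj (\<lambda>n. pick (J n))"
      by (rule injI) (metis less linorder_neqE_nat)
    show "range (\<lambda>n. pick (J n)) \<subseteq> I"
      using pickJ(1) J_mono[of 0] by (auto simp: J_def)
    show "\<exists>h. inj_on h (A (pick (J n))) \<and> h ` A (pick (J n)) \<subseteq> A (pick (J (Suc n)))" for n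
      unfolding card_of_ordLeq using pickJ(1)[of "Suc n"] pickJ(2)[of _ n] by (simp add: J_Suc)
  qed
qed

text \<open>
  Confining the new image to the old one is what permits iteration: a vertex that has been freed
  stays free.
\<close>

lemma forest_embedding_avoid_one:
  assumes forest: "centred_forest Z L" and emb: "forest_embedding f Z L E"
    and U: "infinite U" "U \<subseteq> forest_verts Z L"
  obtains f' u where "u \<in> U" "forest_embedding f' Z L E"
    and "f' ` forest_verts Z L \<subseteq> f ` (forest_verts Z L - {u})"
proof (cases "\<exists>z\<in>Z. infinite (U \<inter> L z)")
  case True
  then obtain z where z: "z \<in> Z" "infinite (U \<inter> L z)"
    by blast
  then obtain u where u: "u \<in> U" "u \<in> L z"
    by (metis IntE finite.emptyI ex_in_conv)
  have sub: "forest_verts Z (L(z := L z - {u})) \<subseteq> forest_verts Z L - {u}"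
    using leaf_of_one_star_only[OF forest] z u
    unfolding forest_verts_def by (auto split: if_splits)
  have "forest_embedding f Z (L(z := L z - {u})) E"
    using emb sub unfolding forest_embedding_def
    by (auto split: if_splits elim: inj_on_subset)
  then obtain f' where "forest_embedding f' Z L E"
      "f' ` forest_verts Z L \<subseteq> f ` forest_verts Z (L(z := L z - {u}))"
    using forest_embedding_fill_star[OF forest z(1)] z(2) by (metis finite_Int)
  with sub u show thesis
    by (intro that[of u f']) (assumption | blast)+
next
  case False
  \<comment> \<open>Every star has only finitely many vertices in \<open>U\<close>, so infinitely many stars meet \<open>U\<close>.\<close>
  define I where "I = {z \<in> Z. (insert z (L z)) \<inter> U \<noteq> {}}"
  have "U \<subseteq> (\<Union>z\<in>I. insert z (U \<inter> L z))"
    using U(2) unfolding I_def forest_verts_def by auto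
  moreover have "finite (insert z (U \<inter> L z))" if "z \<in> I" for z
    using False that by (simp add: I_def)
  ultimately have "infinite I"
    using U(1) by (meson finite_UN_I finite_subset)
  then obtain s where s: "inj s" "range s \<subseteq> I"
      "\<And>n. \<exists>h. inj_on h (L (s n)) \<and> h ` L (s n) \<subseteq> L (s (Suc n))"
    using increasing_sequence_of_sets[where A = L] by metis
  then obtain u where u: "u \<in> U" "u \<in> insert (s 0) (L (s 0))"
    unfolding I_def by blast
  have s0: "s n \<in> Z" for n
    using s(2) by (auto simp: I_def)
  \<comment> \<open>Shift along the sequence of stars, as in Hilbert's hotel.\<close>
  define \<phi> where "\<phi> z = (if z \<in> range s then s (Suc (inv s z)) else z)" for z
  have \<phi>s: "\<phi> (s n) = s (Suc n)" for n
    using s(1) by (simp add: \<phi>_def)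
  have \<phi>id: "\<phi> z = z" if "z \<notin> range s" for z
    using that by (simp add: \<phi>_def)
  have sub: "forest_verts (Z - {s 0}) L \<subseteq> forest_verts Z L - {u}"
    using leaf_of_one_star_only[OF forest] s0 u
    unfolding forest_verts_def by blast
  have forest': "centred_forest (Z - {s 0}) L"
    using forest by (rule centred_forest_subset) auto
  have emb': "forest_embedding f (Z - {s 0}) L E"
    using emb sub unfolding forest_embedding_def by (auto elim: inj_on_subset)
  have inj: "inj_on \<phi> Z"
  proof (rule inj_onI)
    fix x y assume eq: "\<phi> x = \<phi> y"
    have range: "\<phi> z \<in> range s \<longleftrightarrow> z \<in> range s" for z
      using \<phi>s \<phi>id by (cases "z \<in> range s") auto
    show "x = y"
    proof (cases "x \<in> range s")
      case True
      then obtain m n where "x = s m" "y = s n"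
        using range[of x] range[of y] eq by auto
      with eq show ?thesis
        using \<phi>s s(1) by (simp add: inj_eq)
    next
      case False
      then show ?thesis
        using range[of x] range[of y] eq \<phi>id by simp
    qed
  qed
  have into: "\<phi> ` Z \<subseteq> Z - {s 0}"
  proof (rule image_subsetI)
    fix z assume "z \<in> Z"
    then show "\<phi> z \<in> Z - {s 0}"
      using \<phi>s \<phi>id s(1) s0 by (cases "z \<in> range s") (auto dest: injD)
  qed
  have stars: "\<exists>h. inj_on h (L z) \<and> h ` L z \<subseteq> L (\<phi> z)" for z
  proof (cases "z \<in> range s")
    case True
    then show ?thesis
      using s(3) \<phi>s by auto
  next
    case False
    then show ?thesis
      using \<phi>id by (intro exI[of _ id]) auto
  qed
  obtain f' where "forest_embedding f' Z L E"
      "f' ` forest_verts Z L \<subseteq> f ` forest_verts (Z - {s 0}) L"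
    using forest_embedding_transfer[OF forest forest' emb' inj into stars] by metis
  with sub u show thesis
    by (intro that[of u f']) (assumption | blast)+
qed

lemma forest_embedding_avoid_many:
  assumes forest: "centred_forest Z L" and emb: "forest_embedding f Z L E" and X: "infinite X"
  shows "\<exists>f' Y. forest_embedding f' Z L E \<and> f' ` forest_verts Z L \<subseteq> f ` forest_verts Z L \<and>
    Y \<subseteq> X \<and> finite Y \<and> card Y = n \<and> f' ` forest_verts Z L \<inter> Y = {}"
proof (induction n)
  case 0
  show ?case
    using emb by (intro exI[of _ f] exI[of _ "{}"]) auto
next
  case (Suc n)
  let ?V = "forest_verts Z L"
  obtain f' Y where f': "forest_embedding f' Z L E" "f' ` ?V \<subseteq> f ` ?V"
    and Y: "Y \<subseteq> X" "finite Y" "card Y = n" "f' ` ?V \<inter> Y = {}"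
    using Suc.IH by blast
  have inf: "infinite (X - Y)"
    using X Y(2) by simp
  have "\<exists>f'' y. forest_embedding f'' Z L E \<and> f'' ` ?V \<subseteq> f' ` ?V \<and> y \<in> X - Y \<and> y \<notin> f'' ` ?V"
  proof (cases "X - Y \<subseteq> f' ` ?V")
    case False
    then show ?thesis
      using f'(1) by blast
  next
    case True
    define U where "U = {x \<in> ?V. f' x \<in> X - Y}"
    have "f' ` U = X - Y"
      using True by (auto simp: U_def)
    then have "infinite U"
      using inf by (metis finite_imageI)
    moreover have "U \<subseteq> ?V"
      by (auto simp: U_def)
    ultimately obtain f'' u
      where u: "u \<in> U" "forest_embedding f'' Z L E" "f'' ` ?V \<subseteq> f' ` (?V - {u})"
      by (rule forest_embedding_avoid_one[OF forest f'(1)])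
    have "f' u \<notin> f' ` (?V - {u})"
      using f'(1) u(1) by (auto simp: forest_embedding_def U_def dest: inj_onD)
    then have "f' u \<notin> f'' ` ?V" "f'' ` ?V \<subseteq> f' ` ?V"
      using u(3) by blast+
    moreover have "f' u \<in> X - Y"
      using u(1) by (simp add: U_def)
    ultimately show ?thesis
      using u(2) by blast
  qed
  then obtain f'' y where f'': "forest_embedding f'' Z L E" "f'' ` ?V \<subseteq> f' ` ?V"
    and y: "y \<in> X - Y" "y \<notin> f'' ` ?V"
    by blast
  have "f'' ` ?V \<subseteq> f ` ?V" "f'' ` ?V \<inter> insert y Y = {}"
    using f'(2) f''(2) Y(4) y(2) by blast+
  moreover have "insert y Y \<subseteq> X" "finite (insert y Y)" "card (insert y Y) = Suc n"
    using Y(1,2,3) y(1) by auto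
  ultimately show ?case
    using f''(1) by blast
qed

section \<open>Rerouting an embedding around one edge\<close>

text \<open>
  The heart of the argument. The star through the edge \<open>vw\<close> either spares a leaf or is rebuilt
  around \<open>v\<close>; it does not matter whether \<open>v\<close> was its centre or a leaf. Looplessness keeps \<open>v\<close> out
  of its own neighbourhood, from which the new leaves are taken.
\<close>

lemma forest_embedding_drop_edge:
  assumes forest: "centred_forest Z L" and emb: "forest_embedding f Z L (insert {v, w} E)"
    and inf: "infinite {x. {v, x} \<in> E}" and loopless: "{v} \<notin> E"
  shows "\<exists>f'. forest_embedding f' Z L E"
proof (cases "\<exists>z\<in>Z. \<exists>b\<in>L z. {f z, f b} = {v, w}")
  case False
  then show ?thesis
    using emb unfolding forest_embedding_def by blast
next
  case True
  then obtain z b where z: "z \<in> Z" and b: "b \<in> L z" and zb: "{f z, f b} = {v, w}"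
    by blast
  have f_inj: "inj_on f (forest_verts Z L)"
    and f_edge: "\<And>y x. y \<in> Z \<Longrightarrow> x \<in> L y \<Longrightarrow> {f y, f x} \<in> insert {v, w} E"
    using emb by (auto simp: forest_embedding_def)
  have unique: "y = z \<and> x = b" if "y \<in> Z" "x \<in> L y" "{f y, f x} = {v, w}" for y x
  proof -
    have V: "y \<in> forest_verts Z L" "x \<in> forest_verts Z L" "z \<in> forest_verts Z L"
        "b \<in> forest_verts Z L"
      using that z b by (auto simp: forest_verts_def)
    have "f y = f z \<and> f x = f b \<or> f y = f b \<and> f x = f z"
      using that(3) zb by (auto simp: doubleton_eq_iff)
    then have "y = z \<and> x = b \<or> y = b \<and> x = z"
      using f_inj V by (auto dest: inj_onD)
    then show ?thesis
      using that z b leaf_of_one_star_only(2)[OF forest] by blast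
  qed
  show ?thesis
  proof (cases "finite (L z)")
    case False
    let ?L = "L(z := L z - {b})"
    have "forest_embedding f Z ?L E"
    proof (rule forest_embeddingI)
      show "inj_on f (forest_verts Z ?L)"
        using f_inj by (rule inj_on_subset) (auto simp: forest_verts_def split: if_splits)
      show "{f y, f x} \<in> E" if "y \<in> Z" "x \<in> ?L y" for y x
      proof -
        have "x \<in> L y" "\<not> (y = z \<and> x = b)"
          using that(2) by (cases "y = z"; simp)+
        then show ?thesis
          using that(1) f_edge[of y x] unique[of y x] by blast
      qed
    qed
    then show ?thesis
      using forest_embedding_fill_star[OF forest z] False by metis
  next
    case True
    let ?Z = "Z - {z}"
    let ?V = "forest_verts ?Z L"
    have verts: "forest_verts Z L = ?V \<union> insert z (L z)"
      using z by (auto simp: forest_verts_def)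
    have disj: "z \<notin> ?V" "L z \<inter> ?V = {}" "z \<notin> L z"
      using z leaf_of_one_star_only[OF forest] unfolding forest_verts_def by blast+
    have forest': "centred_forest ?Z L"
      using forest by (rule centred_forest_subset) auto
    have "forest_embedding f ?Z L E"
    proof (rule forest_embeddingI)
      show "inj_on f ?V"
        using f_inj verts by (auto elim: inj_on_subset)
      show "{f y, f x} \<in> E" if "y \<in> ?Z" "x \<in> L y" for y x
        using that f_edge[of y x] unique[of y x] by blast
    qed
    from forest_embedding_avoid_many[OF forest' this inf, of "card (L z)"]
    obtain f' Y where f': "forest_embedding f' ?Z L E" "f' ` ?V \<subseteq> f ` ?V"
      and Y: "Y \<subseteq> {x. {v, x} \<in> E}" "finite Y" "card Y = card (L z)" "f' ` ?V \<inter> Y = {}"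
      by blast
    have "v \<notin> f ` ?V"
    proof
      assume "v \<in> f ` ?V"
      then obtain x where x: "x \<in> ?V" "f x = f z \<or> f x = f b"
        using zb by (auto simp: doubleton_eq_iff)
      moreover have "x \<in> forest_verts Z L" "z \<in> forest_verts Z L" "b \<in> forest_verts Z L"
        using x(1) b verts by auto
      ultimately have "x = z \<or> x = b"
        using f_inj by (auto dest: inj_onD)
      then show False
        using x(1) b disj by blast
    qed
    then have v: "v \<notin> f' ` ?V" "v \<notin> Y"
      using f'(2) Y(1) loopless by auto
    obtain h where h: "bij_betw h (L z) Y"
      using True Y(2,3) by (metis finite_same_card_bij)
    \<comment> \<open>Rebuild the star at \<open>v\<close> with leaf set \<open>Y\<close>.\<close>
    define f'' where "f'' x = (if x = z then v else if x \<in> L z then h x else f' x)" for x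
    have f''_simps: "f'' z = v" "\<And>x. x \<in> L z \<Longrightarrow> f'' x = h x" "\<And>x. x \<in> ?V \<Longrightarrow> f'' x = f' x"
      using disj by (auto simp: f''_def)
    have "forest_embedding f'' Z L E"
    proof (rule forest_embeddingI)
      have "inj_on f'' ?V"
        using f'(1) f''_simps(3) by (auto simp: forest_embedding_def inj_on_def)
      moreover have "inj_on f'' (L z)"
        using h f''_simps(2) by (auto simp: bij_betw_def inj_on_def)
      moreover have "f'' ` ?V = f' ` ?V" "f'' ` L z = Y"
        using f''_simps(2,3) h by (auto simp: bij_betw_def image_iff)
      moreover have "inj_on f'' (insert z (L z))"
        using calculation(2,4) v(2) f''_simps(1) by (auto simp: inj_on_insert)
      moreover have "f'' ` ?V \<inter> f'' ` insert z (L z) = {}"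
        using calculation(3,4) v(1) Y(4) f''_simps(1) by auto
      ultimately show "inj_on f'' (forest_verts Z L)"
        unfolding verts by (subst inj_on_Un) blast
      show "{f'' y, f'' x} \<in> E" if "y \<in> Z" "x \<in> L y" for y x
      proof (cases "y = z")
        case True
        then have "f'' x \<in> Y"
          using that h f''_simps(2) by (auto simp: bij_betw_def)
        then show ?thesis
          using True Y(1) f''_simps(1) by auto
      next
        case False
        then have "y \<in> ?Z" "y \<in> ?V" "x \<in> ?V"
          using that by (auto simp: forest_verts_def)
        then show ?thesis
          using that f'(1) f''_simps(3) by (simp add: forest_embedding_def)
      qed
    qed
    then show ?thesis by blast
  qed
qed

section \<open>Star forests and monochromatic copies\<close>

text \<open>
  The centre of a star with a single edge is a matter of choice, so the centres are obtained
  rather than defined from the graph.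
\<close>

lemma star_forest_centred:
  assumes "star_forest G"
  obtains Z L where "centred_forest Z L" "verts G = forest_verts Z L"
    "edges G = {{z, x} |z x. z \<in> Z \<and> x \<in> L z}" "Z \<noteq> {}" "\<And>z. z \<in> Z \<Longrightarrow> L z \<noteq> {}"
proof -
  obtain \<S> where \<S>: "\<S> \<noteq> {}" "\<And>S. S \<in> \<S> \<Longrightarrow> is_star S"
      "\<And>S T. S \<in> \<S> \<Longrightarrow> T \<in> \<S> \<Longrightarrow> S \<noteq> T \<Longrightarrow> verts S \<inter> verts T = {}"
      "verts G = (\<Union>S\<in>\<S>. verts S)" "edges G = (\<Union>S\<in>\<S>. edges S)"
    using assms unfolding star_forest_def by metis
  have "\<forall>S\<in>\<S>. \<exists>p. fst p \<notin> snd p \<and> snd p \<noteq> {} \<and> verts S = insert (fst p) (snd p) \<and>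
      edges S = (\<lambda>x. {fst p, x}) ` snd p"
    using \<S>(2) unfolding is_star_def by simp
  then obtain p where p: "\<And>S. S \<in> \<S> \<Longrightarrow> fst (p S) \<notin> snd (p S) \<and> snd (p S) \<noteq> {} \<and>
      verts S = insert (fst (p S)) (snd (p S)) \<and> edges S = (\<lambda>x. {fst (p S), x}) ` snd (p S)"
    by metis
  define cen where "cen = (\<lambda>S. fst (p S))"
  define lea where "lea = (\<lambda>S. snd (p S))"
  have st: "cen S \<notin> lea S" "lea S \<noteq> {}" "verts S = insert (cen S) (lea S)"
      "edges S = (\<lambda>x. {cen S, x}) ` lea S" if "S \<in> \<S>" for S
    using p[OF that] by (auto simp: cen_def lea_def)
  have same: "S = T" if "S \<in> \<S>" "T \<in> \<S>" "x \<in> verts S" "x \<in> verts T" for S T x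
    using \<S>(3) that by blast
  have inj: "inj_on cen \<S>"
    using same st(3) by (metis inj_onI insertI1)
  define L where "L = (\<lambda>z. lea (inv_into \<S> cen z))"
  have L: "L (cen S) = lea S" if "S \<in> \<S>" for S
    using that inj by (simp add: L_def)
  show thesis
  proof (rule that[of "cen ` \<S>" L])
    show "centred_forest (cen ` \<S>) L"
      unfolding centred_forest_def
    proof (intro conjI ballI impI)
      fix z assume "z \<in> cen ` \<S>"
      then obtain S where S: "S \<in> \<S>" "z = cen S" by blast
      have "cen T \<notin> lea S" if "T \<in> \<S>" for T
      proof (cases "T = S")
        case False
        then have "verts T \<inter> verts S = {}"
          using \<S>(3) S(1) that by blast
        then show ?thesis
          using st(3)[OF that] st(3)[OF S(1)] by blast
      qed (use st(1)[OF that] in auto)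
      then show "cen ` \<S> \<inter> L z = {}"
        using S L by auto
      fix y assume "y \<in> cen ` \<S>" "z \<noteq> y"
      then obtain T where T: "T \<in> \<S>" "y = cen T" "S \<noteq> T" using S by blast
      then have "verts S \<inter> verts T = {}" using \<S>(3) S by blast
      then show "L z \<inter> L y = {}"
        using S T L st(3)[OF S(1)] st(3)[OF T(1)] by blast
    qed
    show "verts G = forest_verts (cen ` \<S>) L"
    proof -
      have "verts G = (\<Union>S\<in>\<S>. insert (cen S) (L (cen S)))"
        using \<S>(4) st(3) L by simp
      also have "\<dots> = forest_verts (cen ` \<S>) L"
        unfolding forest_verts_def by auto
      finally show ?thesis .
    qed
    show "edges G = {{z, x} |z x. z \<in> cen ` \<S> \<and> x \<in> L z}"
    proof -
      have "edges G = (\<Union>S\<in>\<S>. (\<lambda>x. {cen S, x}) ` L (cen S))"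
        using \<S>(5) st(4) L by simp
      also have "\<dots> = {{z, x} |z x. z \<in> cen ` \<S> \<and> x \<in> L z}"
        by auto
      finally show ?thesis .
    qed
  qed (use \<S>(1) st(2) L in auto)
qed

definition mono_edges :: "('c set \<Rightarrow> color) \<Rightarrow> color \<Rightarrow> 'c ugraph \<Rightarrow> 'c set set" where
  "mono_edges c k F = {e \<in> edges F. c e = k}"

text \<open>
  Nonempty leaf sets matter here: without isolated vertices, an embedding of the edges already
  places all vertices inside \<open>F\<close>.
\<close>

lemma mono_copy_iff_embedding:
  assumes simple: "simple_graph F" and forest: "centred_forest Z L"
    and verts: "verts G = forest_verts Z L"
    and edges: "edges G = {{z, x} |z x. z \<in> Z \<and> x \<in> L z}"
    and leaf: "\<And>z. z \<in> Z \<Longrightarrow> L z \<noteq> {}"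
  shows "(\<exists>K. is_copy K G F \<and> (\<forall>e\<in>edges K. c e = k)) \<longleftrightarrow>
    (\<exists>f. forest_embedding f Z L (mono_edges c k F))"
proof
  assume "\<exists>K. is_copy K G F \<and> (\<forall>e\<in>edges K. c e = k)"
  then obtain K f where K: "subgraph K F" "\<And>e. e \<in> edges K \<Longrightarrow> c e = k"
    and f: "bij_betw f (verts G) (verts K)"
      "\<And>u v. u \<in> verts G \<Longrightarrow> v \<in> verts G \<Longrightarrow> {u, v} \<in> edges G \<longleftrightarrow> {f u, f v} \<in> edges K"
    unfolding is_copy_def isomorphic_def by metis
  have "forest_embedding f Z L (mono_edges c k F)"
  proof (rule forest_embeddingI)
    show "inj_on f (forest_verts Z L)"
      using f(1) verts by (auto simp: bij_betw_def)
    show "{f z, f x} \<in> mono_edges c k F" if "z \<in> Z" "x \<in> L z" for z x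
    proof -
      have "{z, x} \<in> edges G" "z \<in> verts G" "x \<in> verts G"
        using that edges verts by (auto simp: forest_verts_def)
      then have "{f z, f x} \<in> edges K"
        using f(2) by simp
      then show ?thesis
        using K by (auto simp: mono_edges_def subgraph_def)
    qed
  qed
  then show "\<exists>f. forest_embedding f Z L (mono_edges c k F)" by blast
next
  assume "\<exists>f. forest_embedding f Z L (mono_edges c k F)"
  then obtain f where f: "inj_on f (verts G)"
      "\<And>z x. z \<in> Z \<Longrightarrow> x \<in> L z \<Longrightarrow> {f z, f x} \<in> mono_edges c k F"
    using verts by (auto simp: forest_embedding_def)
  define K where "K = \<lparr>verts = f ` verts G, edges = (\<lambda>e. f ` e) ` edges G\<rparr>"
  have K_edge: "e \<in> mono_edges c k F \<and> e \<subseteq> verts K" if "e \<in> edges K" for e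
    using that edges verts f(2) by (auto simp: K_def forest_verts_def)
  have K_verts: "verts K \<subseteq> verts F"
  proof
    fix y assume "y \<in> verts K"
    then obtain x where x: "x \<in> verts G" "y = f x" by (auto simp: K_def)
    then obtain z x' where z: "z \<in> Z" "x' \<in> L z" "x = z \<or> x = x'"
      using verts leaf unfolding forest_verts_def by blast
    then have "{f z, f x'} \<in> edges F"
      using f(2) by (auto simp: mono_edges_def)
    then have "{f z, f x'} \<subseteq> verts F"
      using simple by (auto simp: simple_graph_def)
    then show "y \<in> verts F" using z x by auto
  qed
  have "subgraph K F"
    using K_edge K_verts simple by (auto simp: subgraph_def simple_graph_def mono_edges_def)
  moreover have "isomorphic G K"
    unfolding isomorphic_def
  proof (intro exI[of _ f] conjI ballI)
    show "bij_betw f (verts G) (verts K)"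
      using f(1) by (simp add: bij_betw_def K_def)
    fix u v assume uv: "u \<in> verts G" "v \<in> verts G"
    have "e \<subseteq> verts G" if "e \<in> edges G" for e
      using that edges verts by (auto simp: forest_verts_def)
    then have "e = {u, v}" if "e \<in> edges G" "f ` e = f ` {u, v}" for e
      using that uv inj_on_image_eq_iff[OF f(1), of e "{u, v}"] by blast
    then show "{u, v} \<in> edges G \<longleftrightarrow> {f u, f v} \<in> edges K"
      by (auto simp: K_def image_iff)
  qed
  ultimately show "\<exists>K. is_copy K G F \<and> (\<forall>e\<in>edges K. c e = k)"
    using K_edge by (auto simp: is_copy_def mono_edges_def)
qed

text \<open>
  Deleting \<open>vw\<close> is harmless for the colour that stays infinite at \<open>v\<close>, even if \<open>vw\<close> itself
  had been given that colour.
\<close>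

lemma mono_copy_delete_edge:
  assumes simple: "simple_graph F" and G: "star_forest G" and vw: "{v, w} \<in> edges F"
    and inf: "infinite {x. {v, x} \<in> mono_edges c k (F\<lparr>edges := edges F - {{v, w}}\<rparr>)}"
    and copy: "\<exists>K. is_copy K G F \<and> (\<forall>e\<in>edges K. (c({v, w} := k)) e = k)"
  shows "\<exists>K. is_copy K G (F\<lparr>edges := edges F - {{v, w}}\<rparr>) \<and> (\<forall>e\<in>edges K. c e = k)"
proof -
  let ?F = "F\<lparr>edges := edges F - {{v, w}}\<rparr>"
  obtain Z L where ZL: "centred_forest Z L" "verts G = forest_verts Z L"
      "edges G = {{z, x} |z x. z \<in> Z \<and> x \<in> L z}"
    and "Z \<noteq> {}" and leaf: "\<And>z. z \<in> Z \<Longrightarrow> L z \<noteq> {}"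
    by (rule star_forest_centred[OF G], rule that)
  have simple': "simple_graph ?F"
    using simple by (auto simp: simple_graph_def)
  have "mono_edges (c({v, w} := k)) k F = insert {v, w} (mono_edges c k ?F)"
    using vw by (auto simp: mono_edges_def)
  then obtain f where f: "forest_embedding f Z L (insert {v, w} (mono_edges c k ?F))"
    using copy mono_copy_iff_embedding[OF simple ZL leaf, of "c({v, w} := k)" k] by auto
  have "{v} \<notin> mono_edges c k ?F"
    using simple by (auto simp: mono_edges_def simple_graph_def)
  then show ?thesis
    using forest_embedding_drop_edge[OF ZL(1) f inf]
      mono_copy_iff_embedding[OF simple' ZL leaf, of c k] by blast
qed

lemma mono_copy_of_other_colour:
  assumes "is_copy K G F" and col: "\<forall>d\<in>edges K. (c(e := k')) d = k" and "k' \<noteq> k"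
  shows "is_copy K G (F\<lparr>edges := edges F - {e}\<rparr>) \<and> (\<forall>d\<in>edges K. c d = k)"
proof -
  have "e \<notin> edges K"
    using col \<open>k' \<noteq> k\<close> by auto
  then have "\<forall>d\<in>edges K. c d = k"
    using col by (metis fun_upd_apply)
  with \<open>e \<notin> edges K\<close> assms(1) show ?thesis
    by (auto simp: is_copy_def subgraph_def)
qed

section \<open>Deleting an edge at a vertex of infinite degree\<close>

lemma arrows_delete_edge:
  fixes G :: "'a ugraph" and H :: "'b ugraph" and F :: "'c ugraph"
  assumes simple: "simple_graph F" and G: "star_forest G" and H: "star_forest H"
    and arr: "arrows F G H" and inf: "infinite {x. {v, x} \<in> edges F}"
    and vw: "{v, w} \<in> edges F"
  shows "arrows (F\<lparr>edges := edges F - {{v, w}}\<rparr>) G H"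
  unfolding arrows_def
proof
  fix c :: "'c set \<Rightarrow> color"
  let ?F = "F\<lparr>edges := edges F - {{v, w}}\<rparr>"
  let ?N = "\<lambda>k. {x. {v, x} \<in> mono_edges c k ?F}"
  have "{x. {v, x} \<in> edges F} \<subseteq> insert w (?N Red \<union> ?N Blue)"
    by (auto simp: mono_edges_def doubleton_eq_iff) (metis color.exhaust)
  then consider (red) "infinite (?N Red)" | (blue) "infinite (?N Blue)"
    using inf by (meson finite_Un finite_insert finite_subset)
  then show "(\<exists>K. is_copy K G ?F \<and> (\<forall>e\<in>edges K. c e = Red)) \<or>
      (\<exists>K. is_copy K H ?F \<and> (\<forall>e\<in>edges K. c e = Blue))"
  proof cases
    case red
    let ?c = "c({v, w} := Red)"
    from arr consider
        (G) "\<exists>K. is_copy K G F \<and> (\<forall>e\<in>edges K. ?c e = Red)"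
      | (H) K where "is_copy K H F" "\<forall>e\<in>edges K. ?c e = Blue"
      unfolding arrows_def by blast
    then show ?thesis
    proof cases
      case G
      then show ?thesis
        using mono_copy_delete_edge[OF simple \<open>star_forest G\<close> vw red] by blast
    next
      case H
      then show ?thesis
        using mono_copy_of_other_colour[of K H F c "{v, w}" Red Blue] by blast
    qed
  next
    case blue
    let ?c = "c({v, w} := Blue)"
    from arr consider
        (G) K where "is_copy K G F" "\<forall>e\<in>edges K. ?c e = Red"
      | (H) "\<exists>K. is_copy K H F \<and> (\<forall>e\<in>edges K. ?c e = Blue)"
      unfolding arrows_def by blast
    then show ?thesis
    proof cases
      case G
      then show ?thesis
        using mono_copy_of_other_colour[of K G F c "{v, w}" Blue Red] by blast
    next
      case H
      then show ?thesis
        using mono_copy_delete_edge[OF simple \<open>star_forest H\<close> vw blue] by blast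
    qed
  qed
qed

lemma star_forest_copy_has_edge:
  assumes "star_forest G" "is_copy K G F"
  shows "edges K \<noteq> {}"
proof -
  obtain Z L where ZL: "centred_forest Z L" "verts G = forest_verts Z L"
      "edges G = {{z, x} |z x. z \<in> Z \<and> x \<in> L z}" "Z \<noteq> {}" "\<And>z. z \<in> Z \<Longrightarrow> L z \<noteq> {}"
    by (rule star_forest_centred[OF assms(1)], rule that)
  then obtain z x where "z \<in> Z" "x \<in> L z"
    by (metis all_not_in_conv)
  then have "{z, x} \<in> edges G" "z \<in> verts G" "x \<in> verts G"
    unfolding ZL(2,3) forest_verts_def by blast+
  moreover obtain f
    where "\<forall>u\<in>verts G. \<forall>v\<in>verts G. {u, v} \<in> edges G \<longleftrightarrow> {f u, f v} \<in> edges K"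
    using assms(2) unfolding is_copy_def isomorphic_def by metis
  ultimately show ?thesis
    by (metis empty_iff)
qed

lemma infinite_degree_in_copy:
  assumes copy: "is_copy K G F" and C: "component C G" "infinite_star C"
  shows "\<exists>v. infinite {x. {v, x} \<in> edges F}"
proof -
  obtain z L where zL: "verts C = insert z L" "edges C = (\<lambda>x. {z, x}) ` L"
    using C(2) unfolding infinite_star_def is_star_def by blast
  have "infinite L"
    using C(2) zL(2) by (auto simp: infinite_star_def)
  have sub: "verts C \<subseteq> verts G" "edges C \<subseteq> edges G"
    using C(1) by (auto simp: component_def subgraph_def)
  obtain f where f: "inj_on f (verts G)"
      "\<And>u v. u \<in> verts G \<Longrightarrow> v \<in> verts G \<Longrightarrow> {u, v} \<in> edges G \<longleftrightarrow> {f u, f v} \<in> edges K"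
    and KF: "edges K \<subseteq> edges F"
    using copy unfolding is_copy_def isomorphic_def subgraph_def bij_betw_def by metis
  have "{f z, f x} \<in> edges F" if "x \<in> L" for x
  proof -
    have "{z, x} \<in> edges G" "z \<in> verts G" "x \<in> verts G"
      using that sub zL by auto
    then show ?thesis
      using f(2) KF by blast
  qed
  then have "f ` L \<subseteq> {x. {f z, x} \<in> edges F}"
    by blast
  moreover have "infinite (f ` L)"
    using \<open>infinite L\<close> f(1) sub zL by (metis finite_imageD inj_on_subset subset_insertI)
  ultimately show ?thesis
    using finite_subset by blast
qed

text \<open>
  Constant colourings suffice: every copy of a star forest has an edge, so the copy that arises is
  the one in the constant colour.
\<close>

lemma arrows_infinite_degree:
  fixes G :: "'a ugraph" and H :: "'b ugraph" and F :: "'c ugraph"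
  assumes G: "star_forest G" and H: "star_forest H" and arr: "arrows F G H"
    and "(\<exists>C. component C G \<and> infinite_star C) \<or> (\<exists>C. component C H \<and> infinite_star C)"
  shows "\<exists>v. infinite {x. {v, x} \<in> edges F}"
  using assms(4)
proof
  assume C: "\<exists>C. component C G \<and> infinite_star C"
  have "\<exists>K. is_copy K G F"
    using arr[unfolded arrows_def, rule_format, of "\<lambda>_. Red"] star_forest_copy_has_edge[OF H]
    by fastforce
  with C show ?thesis
    using infinite_degree_in_copy by blast
next
  assume C: "\<exists>C. component C H \<and> infinite_star C"
  have "\<exists>K. is_copy K H F"
    using arr[unfolded arrows_def, rule_format, of "\<lambda>_. Blue"] star_forest_copy_has_edge[OF G]
    by fastforce
  with C show ?thesis
    using infinite_degree_in_copy by blast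
qed

theorem theorem1p3:
  fixes G :: "'a ugraph" and H :: "'b ugraph"
  assumes "star_forest G" and "star_forest H"
    and "(\<exists>C. component C G \<and> infinite_star C) \<or> (\<exists>C. component C H \<and> infinite_star C)"
  shows "\<not> (\<exists>F :: 'c ugraph. ramsey_minimal G H F)"
proof
  assume "\<exists>F :: 'c ugraph. ramsey_minimal G H F"
  then obtain F :: "'c ugraph" where F: "simple_graph F" "arrows F G H"
      "\<And>F'. subgraph F' F \<Longrightarrow> F' \<noteq> F \<Longrightarrow> \<not> arrows F' G H"
    unfolding ramsey_minimal_def by blast
  obtain v where v: "infinite {x. {v, x} \<in> edges F}"
    using arrows_infinite_degree[OF assms(1,2) F(2) assms(3)] by blast
  then obtain w where w: "{v, w} \<in> edges F"
    by (metis (no_types, lifting) Collect_empty_eq finite.emptyI)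
  let ?F = "F\<lparr>edges := edges F - {{v, w}}\<rparr>"
  have "subgraph ?F F"
    using F(1) by (auto simp: subgraph_def simple_graph_def)
  moreover have "?F \<noteq> F"
  proof
    assume "?F = F"
    then have "edges ?F = edges F" by (rule arg_cong)
    with w show False by auto
  qed
  ultimately show False
    using F(3) arrows_delete_edge[OF F(1) assms(1,2) F(2) v w] by blast
qed

end
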